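(* Let $B$ be an infinite set. (a) Let $E$ be a separated lim-rim over $B$ which is $|E|$-exact. Let $M$ be a lim-rim over $B$ with $|M|\le|E|$ and let $M'\subset M$ be a sub-lim-rim with $|M'|<|E|$. Then every embedding $M'\to E$ extends to an embedding $M\to E$. (b) Let $E_1,E_2$ be separated lim-rims over $B$ with the same cardinality $\kappa=|E_1|=|E_2|$, both $\kappa$-exact. Then every isomorphism between a sub-lim-rim of $E_1$ and a sub-lim-rim of $E_2$, both of cardinality $<\kappa$, extends to an isomorphism $E_1\to E_2$. In particular $E_1$ and $E_2$ are isomorphic.
   Context: For sets $B,E$, a cylinder of $B^E$ is a subset of the form $\{\psi\in B^E:\psi|_J\in R\}$ with $J\subset E$ finite and $R\subset B^J$; the cylinders form a Boolean algebra. A lim-rim over $B$ is a set $E$ together with an ultrafilter $\mathcal L$ in the cylinder Boolean algebra of $B^E$. It is separated if $\{\psi\in B^E:\psi_e=\psi_{e'}\}\in\mathcal L$ implies $e=e'$. For $\eta:I\to E$, let $\mathcal L_\eta$ be the ultrafilter in the cylinder algebra of $B^I$ consisting of the cylinders $C$ with $\{\psi\in B^E:\psi\circ\eta\in C\}\in\mathcal L$. For a cardinal $m$, $E$ is $m$-exact if for every set $I$ with $|I|<m$, every $i\notin I$, every $\eta:I\to E$, and every ultrafilter $\mathcal U$ in the cylinder algebra of $B^{I\cup\{i\}}$ whose projection to $B^I$ (the set of cylinders of $B^I$ whose preimage under restriction $B^{I\cup\{i\}}\to B^I$ is in $\mathcal U$) equals $\mathcal L_\eta$, there is an extension $\eta':I\cup\{i\}\to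 E$ of $\eta$ with $\mathcal L_{\eta'}=\mathcal U$. Any subset $E'\subset E$ is a lim-rim over $B$ (a sub-lim-rim) with ultrafilter $\mathcal L_\iota$, $\iota:E'\to E$ the inclusion. An embedding of a lim-rim $(M,\mathcal L_M)$ over $B$ in $(E,\mathcal L)$ is a map $f:M\to E$ respecting the ultrafilters, i.e. $\mathcal L_f=\mathcal L_M$ (it is automatically injective if $M$ is separated). An isomorphism is a bijection respecting the ultrafilters. *)

theory Defs
  imports Main "HOL-Library.FuncSet"
begin

unbundle cardinal_syntax

text \<open>
  The power \<open>B\<^sup>E\<close> is the set \<open>E \<rightarrow>\<^sub>E B\<close> of functions that are \<open>undefined\<close> outside \<open>E\<close>, so the
  restriction map \<open>B\<^sup>E \<rightarrow> B\<^sup>J\<close> is \<open>\<lambda>\<psi>. restrict \<psi> J\<close> and \<open>\<psi> \<circ> \<eta>\<close>, as an element of \<open>B\<^sup>I\<close>, is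
  \<open>compose I \<psi> \<eta>\<close>.
\<close>

definition cylinders :: "'b set \<Rightarrow> 'e set \<Rightarrow> ('e \<Rightarrow> 'b) set set" where
  "cylinders B E =
     {{\<psi> \<in> E \<rightarrow>\<^sub>E B. restrict \<psi> J \<in> R} | J R. finite J \<and> J \<subseteq> E \<and> R \<subseteq> (J \<rightarrow>\<^sub>E B)}"

definition cyl_ultrafilter :: "'b set \<Rightarrow> 'e set \<Rightarrow> ('e \<Rightarrow> 'b) set set \<Rightarrow> bool" where
  "cyl_ultrafilter B E L \<longleftrightarrow>
     L \<subseteq> cylinders B E \<and>
     (E \<rightarrow>\<^sub>E B) \<in> L \<and> {} \<notin> L \<and>
     (\<forall>C\<in>L. \<forall>D\<in>L. C \<inter> D \<in> L) \<and>
     (\<forall>C\<in>L. \<forall>D\<in>cylinders B E. C \<subseteq> D \<longrightarrow> D \<in> L) \<and>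
     (\<forall>C\<in>cylinders B E. C \<in> L \<or> (E \<rightarrow>\<^sub>E B) - C \<in> L)"

definition lim_rim :: "'b set \<Rightarrow> 'e set \<Rightarrow> ('e \<Rightarrow> 'b) set set \<Rightarrow> bool" where
  "lim_rim B E L \<longleftrightarrow> cyl_ultrafilter B E L"

definition separated :: "'b set \<Rightarrow> 'e set \<Rightarrow> ('e \<Rightarrow> 'b) set set \<Rightarrow> bool" where
  "separated B E L \<longleftrightarrow> (\<forall>e\<in>E. \<forall>e'\<in>E. {\<psi> \<in> E \<rightarrow>\<^sub>E B. \<psi> e = \<psi> e'} \<in> L \<longrightarrow> e = e')"

text \<open>The ultrafilter \<open>L\<^sub>\<eta>\<close> on \<open>B\<^sup>I\<close>, for \<open>\<eta> : I \<rightarrow> E\<close>.\<close>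

definition pull_uf ::
  "'b set \<Rightarrow> 'e set \<Rightarrow> ('e \<Rightarrow> 'b) set set \<Rightarrow> 'i set \<Rightarrow> ('i \<Rightarrow> 'e) \<Rightarrow> ('i \<Rightarrow> 'b) set set" where
  "pull_uf B E L I \<eta> = {C \<in> cylinders B I. {\<psi> \<in> E \<rightarrow>\<^sub>E B. compose I \<psi> \<eta> \<in> C} \<in> L}"

text \<open>The projection to \<open>B\<^sup>I\<close> of an ultrafilter \<open>U\<close> on \<open>B\<^sup>K\<close>, where \<open>I \<subseteq> K\<close>.\<close>

definition proj_uf ::
  "'b set \<Rightarrow> 'i set \<Rightarrow> ('i \<Rightarrow> 'b) set set \<Rightarrow> 'i set \<Rightarrow> ('i \<Rightarrow> 'b) set set" where
  "proj_uf B K U I = {C \<in> cylinders B I. {\<psi> \<in> K \<rightarrow>\<^sub>E B. restrict \<psi> I \<in> C} \<in> U}"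

text \<open>
  A cardinal is a relation \<open>m\<close> with \<open>Card_order m\<close>. The index sets \<open>I\<close> range over subsets of
  the type underlying \<open>m\<close>; lemma \<open>exact_any_type\<close> below shows that the property
  then holds for index sets \<open>I\<close> in every type.
\<close>

definition exact :: "'m rel \<Rightarrow> 'b set \<Rightarrow> 'e set \<Rightarrow> ('e \<Rightarrow> 'b) set set \<Rightarrow> bool" where
  "exact m B E L \<longleftrightarrow>
     (\<forall>(I :: 'm set) i \<eta> U.
        |I| <o m \<and> i \<notin> I \<and> \<eta> \<in> I \<rightarrow> E \<and>
        cyl_ultrafilter B (insert i I) U \<and>
        proj_uf B (insert i I) U I = pull_uf B E L I \<eta> \<longrightarrow>
        (\<exists>\<eta>' \<in> insert i I \<rightarrow> E.
           (\<forall>j\<in>I. \<eta>' j = \<eta> j) \<and> pull_uf B E L (insert i I) \<eta>' = U))"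

definition sub_rim :: "'b set \<Rightarrow> 'e set \<Rightarrow> ('e \<Rightarrow> 'b) set set \<Rightarrow> 'e set \<Rightarrow> ('e \<Rightarrow> 'b) set set" where
  "sub_rim B E L E' = pull_uf B E L E' (\<lambda>e. e)"

definition rim_embedding ::
  "'b set \<Rightarrow> 'm set \<Rightarrow> ('m \<Rightarrow> 'b) set set \<Rightarrow> 'e set \<Rightarrow> ('e \<Rightarrow> 'b) set set \<Rightarrow> ('m \<Rightarrow> 'e) \<Rightarrow> bool" where
  "rim_embedding B M LM E L f \<longleftrightarrow> f \<in> M \<rightarrow> E \<and> pull_uf B E L M f = LM"

definition rim_iso ::
  "'b set \<Rightarrow> 'm set \<Rightarrow> ('m \<Rightarrow> 'b) set set \<Rightarrow> 'e set \<Rightarrow> ('e \<Rightarrow> 'b) set set \<Rightarrow> ('m \<Rightarrow> 'e) \<Rightarrow> bool" where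
  "rim_iso B M LM E L f \<longleftrightarrow> bij_betw f M E \<and> pull_uf B E L M f = LM"


lemma restrict_in_PiE: "\<psi> \<in> E \<rightarrow>\<^sub>E B \<Longrightarrow> J \<subseteq> E \<Longrightarrow> restrict \<psi> J \<in> J \<rightarrow>\<^sub>E B"
  by (auto simp: PiE_def Pi_def)

lemma cylindersI:
  assumes "finite J" "J \<subseteq> E"
  shows "{\<psi> \<in> E \<rightarrow>\<^sub>E B. P (restrict \<psi> J)} \<in> cylinders B E"
proof -
  have "{\<psi> \<in> E \<rightarrow>\<^sub>E B. P (restrict \<psi> J)}
      = {\<psi> \<in> E \<rightarrow>\<^sub>E B. restrict \<psi> J \<in> {\<chi> \<in> J \<rightarrow>\<^sub>E B. P \<chi>}}"
    using restrict_in_PiE[OF _ assms(2)] by blast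
  then show ?thesis
    unfolding cylinders_def using assms by blast
qed

lemma cylindersE:
  assumes "C \<in> cylinders B E"
  obtains J P where "finite J" "J \<subseteq> E" "C = {\<psi> \<in> E \<rightarrow>\<^sub>E B. P (restrict \<psi> J)}"
proof -
  from assms obtain J R where J: "finite J" "J \<subseteq> E" and C: "C = {\<psi> \<in> E \<rightarrow>\<^sub>E B. restrict \<psi> J \<in> R}"
    unfolding cylinders_def by blast
  from that[of J "\<lambda>\<chi>. \<chi> \<in> R", OF J C] show thesis .
qed

lemma cylinders_top: "(E \<rightarrow>\<^sub>E B) \<in> cylinders B E"
  using cylindersI[of "{}" E B "\<lambda>_. True"] by simp

lemma cylinders_empty: "{} \<in> cylinders B E"
  using cylindersI[of "{}" E B "\<lambda>_. False"] by simp

lemma cylinders_Diff: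
  assumes "C \<in> cylinders B E"
  shows "(E \<rightarrow>\<^sub>E B) - C \<in> cylinders B E"
proof -
  obtain J P where J: "finite J" "J \<subseteq> E" and C: "C = {\<psi> \<in> E \<rightarrow>\<^sub>E B. P (restrict \<psi> J)}"
    using cylindersE[OF assms] .
  have "(E \<rightarrow>\<^sub>E B) - C = {\<psi> \<in> E \<rightarrow>\<^sub>E B. \<not> P (restrict \<psi> J)}"
    using C by auto
  then show ?thesis
    using cylindersI[OF J, of B "\<lambda>\<chi>. \<not> P \<chi>"] by simp
qed

lemma cylinders_Int:
  fixes B :: "'b set"
  assumes "C \<in> cylinders B E" "D \<in> cylinders B E"
  shows "C \<inter> D \<in> cylinders B E"
proof -
  obtain J P where J: "finite J" "J \<subseteq> E" and C: "C = {\<psi> \<in> E \<rightarrow>\<^sub>E B. P (restrict \<psi> J)}"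
    using cylindersE[OF assms(1)] .
  obtain K Q where K: "finite K" "K \<subseteq> E" and D: "D = {\<psi> \<in> E \<rightarrow>\<^sub>E B. Q (restrict \<psi> K)}"
    using cylindersE[OF assms(2)] .
  have r: "restrict (restrict \<psi> (J \<union> K)) J = restrict \<psi> J"
          "restrict (restrict \<psi> (J \<union> K)) K = restrict \<psi> K" for \<psi> :: "_ \<Rightarrow> 'b"
    by (auto simp: restrict_def)
  have "C \<inter> D = {\<psi> \<in> E \<rightarrow>\<^sub>E B. P (restrict (restrict \<psi> (J \<union> K)) J) \<and> Q (restrict (restrict \<psi> (J \<union> K)) K)}"
    unfolding r C D by auto
  then show ?thesis
    using cylindersI[of "J \<union> K" E B "\<lambda>\<chi>. P (restrict \<chi> J) \<and> Q (restrict \<chi> K)"] J K by simp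
qed

lemma compose_in_PiE: "\<psi> \<in> E \<rightarrow>\<^sub>E B \<Longrightarrow> \<eta> \<in> I \<rightarrow> E \<Longrightarrow> compose I \<psi> \<eta> \<in> I \<rightarrow>\<^sub>E B"
  by (auto simp: compose_def PiE_def Pi_def)

lemma cylinders_vimage:
  assumes "C \<in> cylinders B I" "\<eta> \<in> I \<rightarrow> E"
  shows "{\<psi> \<in> E \<rightarrow>\<^sub>E B. compose I \<psi> \<eta> \<in> C} \<in> cylinders B E"
proof -
  obtain J P where J: "finite J" "J \<subseteq> I" and C: "C = {\<psi> \<in> I \<rightarrow>\<^sub>E B. P (restrict \<psi> J)}"
    using cylindersE[OF assms(1)] .
  have r: "restrict (compose I \<psi> \<eta>) J = compose J (restrict \<psi> (\<eta> ` J)) \<eta>" for \<psi>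
    using J by (auto simp: compose_def restrict_def fun_eq_iff)
  have "{\<psi> \<in> E \<rightarrow>\<^sub>E B. compose I \<psi> \<eta> \<in> C}
      = {\<psi> \<in> E \<rightarrow>\<^sub>E B. P (compose J (restrict \<psi> (\<eta> ` J)) \<eta>)}"
    using compose_in_PiE[OF _ assms(2)] unfolding C r[symmetric] by blast
  moreover have "finite (\<eta> ` J)" "\<eta> ` J \<subseteq> E"
    using J assms(2) by auto
  ultimately show ?thesis
    using cylindersI[of "\<eta> ` J" E B "\<lambda>\<chi>. P (compose J \<chi> \<eta>)"] by simp
qed

lemma cyl_ultrafilter_pull_uf:
  assumes L: "cyl_ultrafilter B E L" and \<eta>: "\<eta> \<in> I \<rightarrow> E"
  shows "cyl_ultrafilter B I (pull_uf B E L I \<eta>)"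
proof -
  define V where "V C = {\<psi> \<in> E \<rightarrow>\<^sub>E B. compose I \<psi> \<eta> \<in> C}" for C
  have V: "C \<in> cylinders B I \<Longrightarrow> V C \<in> cylinders B E" for C
    unfolding V_def using \<eta> by (rule cylinders_vimage[rotated])
  have pull: "pull_uf B E L I \<eta> = {C \<in> cylinders B I. V C \<in> L}"
    unfolding pull_uf_def V_def ..
  have top: "V (I \<rightarrow>\<^sub>E B) = (E \<rightarrow>\<^sub>E B)" and empty: "V {} = {}"
    and Int: "V (C \<inter> D) = V C \<inter> V D" and mono: "C \<subseteq> D \<Longrightarrow> V C \<subseteq> V D"
    and Diff: "V ((I \<rightarrow>\<^sub>E B) - C) = (E \<rightarrow>\<^sub>E B) - V C" for C D
    unfolding V_def using compose_in_PiE[OF _ \<eta>] by blast+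
  show ?thesis
    unfolding cyl_ultrafilter_def pull
    using L[unfolded cyl_ultrafilter_def]
    by (auto simp: top empty Int Diff cylinders_top cylinders_Int cylinders_Diff V
        dest: mono intro: V)
qed

lemma pull_uf_cong:
  fixes B :: "'b set"
  assumes "\<And>i. i \<in> I \<Longrightarrow> \<eta> i = \<theta> i"
  shows "pull_uf B E L I \<eta> = pull_uf B E L I \<theta>"
proof -
  have "compose I \<psi> \<eta> = compose I \<psi> \<theta>" for \<psi> :: "_ \<Rightarrow> 'b"
    using assms by (auto simp: compose_def)
  then show ?thesis unfolding pull_uf_def by simp
qed

lemma pull_uf_pull_uf:
  fixes B :: "'b set" and H :: "'h set"
  assumes "\<theta> \<in> H \<rightarrow> I" "\<eta> \<in> I \<rightarrow> E"
  shows "pull_uf B I (pull_uf B E L I \<eta>) H \<theta> = pull_uf B E L H (\<lambda>h. \<eta> (\<theta> h))"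
proof -
  have c: "compose H (compose I \<psi> \<eta>) \<theta> = compose H \<psi> (\<lambda>h. \<eta> (\<theta> h))" for \<psi> :: "_ \<Rightarrow> 'b"
    using assms by (auto simp: compose_def fun_eq_iff)
  have "{\<psi> \<in> E \<rightarrow>\<^sub>E B. compose I \<psi> \<eta> \<in> {\<psi> \<in> I \<rightarrow>\<^sub>E B. compose H \<psi> \<theta> \<in> C}}
      = {\<psi> \<in> E \<rightarrow>\<^sub>E B. compose H \<psi> (\<lambda>h. \<eta> (\<theta> h)) \<in> C}" for C :: "('h \<Rightarrow> 'b) set"
    unfolding c[symmetric] using compose_in_PiE[OF _ assms(2)] by blast
  then show ?thesis
    unfolding pull_uf_def using cylinders_vimage[OF _ assms(1)] by auto
qed

lemma proj_uf_eq: "proj_uf B K U I = pull_uf B K U I (\<lambda>i. i)"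
  unfolding proj_uf_def pull_uf_def compose_def restrict_def ..

lemma pull_uf_id:
  assumes "cyl_ultrafilter B K U"
  shows "pull_uf B K U K (\<lambda>i. i) = U"
proof -
  have U: "U \<subseteq> cylinders B K" using assms unfolding cyl_ultrafilter_def by blast
  have e: "compose K \<psi> (\<lambda>i. i) = \<psi>" if "\<psi> \<in> K \<rightarrow>\<^sub>E B" for \<psi>
    using that by (auto simp: compose_def fun_eq_iff PiE_def extensional_def)
  have s: "C \<subseteq> (K \<rightarrow>\<^sub>E B)" if "C \<in> cylinders B K" for C
    using that unfolding cylinders_def by blast
  have "{\<psi> \<in> K \<rightarrow>\<^sub>E B. compose K \<psi> (\<lambda>i. i) \<in> C} = C" if "C \<in> cylinders B K" for C
    using s[OF that] e by auto
  then show ?thesis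
    unfolding pull_uf_def using U by auto
qed

lemma exact_any_type:
  fixes m :: "'m rel" and I :: "'i set"
  assumes m: "Card_order m" and ex: "exact m B E L"
    and I: "|I| <o m" and i: "i \<notin> I" and \<eta>: "\<eta> \<in> I \<rightarrow> E"
    and U: "cyl_ultrafilter B (insert i I) U"
    and proj: "proj_uf B (insert i I) U I = pull_uf B E L I \<eta>"
  shows "\<exists>\<eta>' \<in> insert i I \<rightarrow> E. (\<forall>j\<in>I. \<eta>' j = \<eta> j) \<and> pull_uf B E L (insert i I) \<eta>' = U"
proof -
  have Fm: "|Field m| =o m" using m by (rule card_of_Field_ordIso)
  have I': "|I| <o |Field m|"
    using ordLess_ordIso_trans[OF I ordIso_symmetric[OF Fm]] .
  then obtain g0 where g0: "inj_on g0 I" "g0 ` I \<subseteq> Field m"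
    using card_of_ordLeq[of I "Field m"] ordLess_imp_ordLeq[OF I'] by blast
  have "\<not> Field m \<subseteq> g0 ` I"
  proof
    assume "Field m \<subseteq> g0 ` I"
    then have "|Field m| \<le>o |I|"
      using ordLeq_transitive[OF card_of_mono1 card_of_image] by blast
    then show False using I' not_ordLess_ordLeq by blast
  qed
  then obtain x where x: "x \<notin> g0 ` I" by blast
  define K where "K = insert i I"
  define g where "g = g0(i := x)"
  have gI: "g ` I = g0 ` I" using i unfolding g_def by auto
  have inj: "inj_on g K"
    unfolding K_def using g0(1) x i unfolding g_def by (auto simp: inj_on_def)
  have gK: "g ` K = insert (g i) (g ` I)" unfolding K_def by simp
  have gi: "g i \<notin> g ` I" using x gI unfolding g_def by simp
  define h where "h = inv_into K g"
  have hg: "h (g k) = k" if "k \<in> K" for k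
    unfolding h_def using inj that by simp
  have hK: "h \<in> g ` K \<rightarrow> K" using hg by auto
  have hI: "h \<in> g ` I \<rightarrow> I" using hg unfolding K_def by auto
  define U' where "U' = pull_uf B K U (g ` K) h"
  have U0: "cyl_ultrafilter B K U" using U unfolding K_def .
  have 1: "|g ` I| <o m"
    using ordLeq_ordLess_trans[OF card_of_image I] .
  have 2: "(\<lambda>k. \<eta> (h k)) \<in> g ` I \<rightarrow> E" using hI \<eta> by auto
  have 3: "cyl_ultrafilter B (insert (g i) (g ` I)) U'"
    unfolding U'_def gK[symmetric] using U0 hK by (rule cyl_ultrafilter_pull_uf)
  have "proj_uf B (g ` K) U' (g ` I) = pull_uf B K U (g ` I) h"
    unfolding proj_uf_eq U'_def
    by (subst pull_uf_pull_uf) (use hK in \<open>auto simp: K_def\<close>)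
  also have "\<dots> = pull_uf B I (pull_uf B K U I (\<lambda>i. i)) (g ` I) h"
    by (subst pull_uf_pull_uf) (use hI in \<open>auto simp: K_def\<close>)
  also have "\<dots> = pull_uf B I (pull_uf B E L I \<eta>) (g ` I) h"
    using proj unfolding proj_uf_eq K_def by simp
  also have "\<dots> = pull_uf B E L (g ` I) (\<lambda>k. \<eta> (h k))"
    using hI \<eta> by (rule pull_uf_pull_uf)
  finally have 4: "proj_uf B (insert (g i) (g ` I)) U' (g ` I) = pull_uf B E L (g ` I) (\<lambda>k. \<eta> (h k))"
    unfolding gK .
  obtain \<theta> where \<theta>: "\<theta> \<in> insert (g i) (g ` I) \<rightarrow> E" "\<forall>j\<in>g ` I. \<theta> j = \<eta> (h j)"
    "pull_uf B E L (insert (g i) (g ` I)) \<theta> = U'"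
    using ex[unfolded exact_def, rule_format, OF conjI[OF 1 conjI[OF gi conjI[OF 2 conjI[OF 3 4]]]]]
    by blast
  have "pull_uf B E L K (\<lambda>k. \<theta> (g k)) = pull_uf B (g ` K) U' K g"
    unfolding \<theta>(3)[symmetric] gK[symmetric]
    by (rule pull_uf_pull_uf[symmetric]) (use \<theta>(1) gK in auto)
  also have "\<dots> = pull_uf B K U K (\<lambda>k. h (g k))"
    unfolding U'_def by (rule pull_uf_pull_uf) (use hK in auto)
  also have "\<dots> = pull_uf B K U K (\<lambda>k. k)"
    by (rule pull_uf_cong) (rule hg)
  also have "\<dots> = U" using U0 by (rule pull_uf_id)
  finally have "pull_uf B E L (insert i I) (\<lambda>k. \<theta> (g k)) = U" unfolding K_def .
  moreover have "(\<lambda>k. \<theta> (g k)) \<in> insert i I \<rightarrow> E" using \<theta>(1) by auto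
  moreover have "\<forall>j\<in>I. \<theta> (g j) = \<eta> j" using \<theta>(2) hg unfolding K_def by simp
  ultimately show ?thesis by (intro bexI[of _ "\<lambda>k. \<theta> (g k)"] conjI)
qed

end

theory Submission
  imports Defs
begin

text \<open>
  This is a back-and-forth argument. Instead of partial maps between two lim-rims \<open>E1\<close> and \<open>E2\<close>,
  the construction uses relations \<open>R \<subseteq> E1 \<times> E2\<close> whose two coordinate projections pull the
  ultrafilters of \<open>E1\<close> and \<open>E2\<close> back to the same ultrafilter on \<open>B\<^sup>R\<close>. Call such a relation a
  matching. This notion is symmetric in \<open>E1\<close> and \<open>E2\<close>, and three facts about it give the theorem.

  First, a cylinder sees only finitely many coordinates, so being a matching has finite character
  (\<open>matching_finite_character\<close>); hence unions of chains of matchings are matchings. Second, exactness of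
  \<open>E2\<close> allows one to enlarge a small matching to cover any given element of \<open>E1\<close>
  (\<open>matching_forth\<close>), and exactness of \<open>E1\<close> gives the symmetric statement (\<open>matching_back\<close>). Third,
  a matching that is total on \<open>E1\<close> contains the graph of an embedding
  (\<open>matching_total_embedding\<close>), and if the lim-rims are separated, then a matching is the graph of
  an injective partial map, because the ultrafilters alone decide which elements are equal
  (\<open>matching_single_valued\<close>).

  By transfinite recursion, the first two facts let one meet \<open>\<kappa>\<close> many requirements of the form
  "this element is covered" one after the other (\<open>finite_character_meets_all\<close>). For (a) the
  requirements are the elements of \<open>M\<close>, for (b) they are the elements of both lim-rims.
  Fewer than \<open>\<kappa>\<close> pairs are present at each stage as long as \<open>\<kappa>\<close> is infinite. The infinity of
  \<open>B\<close> guarantees this: exactness over the empty index set realises each principal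
  ultrafilter of \<open>B\<close> by an element of \<open>E\<close> (\<open>exact_infinite\<close>).
\<close>

section \<open>Meeting requirements by transfinite recursion\<close>

text \<open>
  The requirements are sets \<open>A \<in> T\<close>, and the final set has to meet each of them. They are
  well-ordered in the order type of a cardinal, so that each one has fewer than \<open>\<kappa>\<close> predecessors
  and the set built before its turn is still small. Finite character replaces the limit steps.
\<close>

lemma finite_character_meets_all:
  fixes P :: "'a set \<Rightarrow> bool" and T :: "'a set set" and \<kappa> :: "'k rel"
  assumes \<kappa>: "Card_order \<kappa>" "infinite (Field \<kappa>)"
    and fin: "\<And>R. P R \<longleftrightarrow> (\<forall>F\<subseteq>R. finite F \<longrightarrow> P F)"
    and step: "\<And>R A. P R \<Longrightarrow> |R| <o \<kappa> \<Longrightarrow> A \<in> T \<Longrightarrow> \<exists>s\<in>A. P (insert s R)"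
    and T: "|T| \<le>o \<kappa>"
    and R0: "P R0" "|R0| <o \<kappa>"
  shows "\<exists>R. R0 \<subseteq> R \<and> P R \<and> (\<forall>A\<in>T. R \<inter> A \<noteq> {})"
proof -
  have mono: "P F" if "P R" "F \<subseteq> R" for F R
    using that fin[of R] fin[of F] by blast
  define r where "r = |T|"
  have cr: "Card_order r" unfolding r_def by (rule card_of_Card_order)
  have fr: "Field r = T" unfolding r_def by (rule Field_card_of)
  have wo: "Well_order r" using cr by (simp add: card_order_on_def)
  have wf: "wf (r - Id)" using wo by (simp add: well_order_on_def)
  have tot: "total_on T r" and tr: "trans r" and rf: "refl_on T r"
    using wo fr unfolding well_order_on_def linear_order_on_def partial_order_on_def preorder_on_def
    by auto
  have und: "underS r A = {A'. (A', A) \<in> r - Id}" for A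
    unfolding underS_def by auto
  have undT: "underS r A \<subseteq> T" for A
    unfolding underS_def using fr by (auto simp: Field_def)
  define Q where "Q g A s \<longleftrightarrow> (A \<in> T \<longrightarrow> s \<in> A \<and> P (insert s (R0 \<union> g ` underS r A)))"
    for g :: "'a set \<Rightarrow> 'a" and A s
  \<comment> \<open>A finite part of the set built so far already occurs at the stage of its latest requirement.\<close>
  have limit: "P (R0 \<union> g ` D)" if D: "D \<subseteq> T" and g: "\<And>A. A \<in> D \<Longrightarrow> Q g A (g A)" for g D
  proof -
    have "P F" if F: "F \<subseteq> R0 \<union> g ` D" "finite F" for F
    proof -
      have "finite (F - R0)" "F - R0 \<subseteq> g ` D" using F by auto
      then obtain G where G: "G \<subseteq> D" "finite G" "F - R0 = g ` G"
        by (meson finite_subset_image)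
      show "P F"
      proof (cases "G = {}")
        case True
        then have "F \<subseteq> R0" using G by auto
        then show ?thesis using mono R0 by blast
      next
        case False
        have "\<exists>A\<in>G. \<forall>A'\<in>G. (A', A) \<in> r"
          using G(2) False subset_trans[OF G(1) D]
        proof (induction G rule: finite_ne_induct)
          case (singleton A)
          then show ?case using rf by (auto simp: refl_on_def)
        next
          case (insert A G)
          then obtain A1 where A1: "A1 \<in> G" "\<forall>A'\<in>G. (A', A1) \<in> r" by auto
          have "(A, A1) \<in> r \<or> (A1, A) \<in> r \<or> A = A1"
            using tot insert.prems A1(1) unfolding total_on_def by blast
          moreover have "(A, A) \<in> r" using rf insert.prems by (auto simp: refl_on_def)
          ultimately show ?case using A1 transD[OF tr] by blast
        qed
        then obtain A where A: "A \<in> G" "\<forall>A'\<in>G. (A', A) \<in> r" by blast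
        have "F \<subseteq> insert (g A) (R0 \<union> g ` underS r A)"
          using G(3) A unfolding und by auto
        moreover have "P (insert (g A) (R0 \<union> g ` underS r A))"
          using g[of A] A(1) G(1) D unfolding Q_def by blast
        ultimately show ?thesis using mono by blast
      qed
    qed
    then show ?thesis using fin[of "R0 \<union> g ` D"] by blast
  qed
  have "\<exists>g. \<forall>A. Q g A (g A)"
  proof (rule dependent_wf_choice[OF wf])
    fix g h :: "'a set \<Rightarrow> 'a" and A s
    assume eq: "\<And>A'. (A', A) \<in> r - Id \<Longrightarrow> g A' = h A'"
    have "g ` underS r A = h ` underS r A"
      unfolding und using eq by (auto intro!: image_cong)
    then show "Q g A s = Q h A s" unfolding Q_def by simp
  next
    fix A and g :: "'a set \<Rightarrow> 'a"
    assume IH: "\<And>A'. (A', A) \<in> r - Id \<Longrightarrow> Q g A' (g A')"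
    show "\<exists>s. Q g A s"
    proof (cases "A \<in> T")
      case True
      have "|underS r A| <o r"
        using card_of_underS[OF cr] True fr by auto
      then have "|underS r A| <o \<kappa>"
        using ordLess_ordLeq_trans T unfolding r_def by blast
      then have "|g ` underS r A| <o \<kappa>"
        using ordLeq_ordLess_trans[OF card_of_image] by blast
      then have "|R0 \<union> g ` underS r A| <o \<kappa>"
        using card_of_Un_ordLess_infinite_Field[OF \<kappa>(2,1) R0(2)] by blast
      moreover have "P (R0 \<union> g ` underS r A)"
        using limit[OF undT[of A]] IH unfolding und by blast
      ultimately show ?thesis
        using step True unfolding Q_def by blast
    qed (simp add: Q_def)
  qed
  then obtain g where g: "\<And>A. Q g A (g A)" by blast
  have "P (R0 \<union> g ` T)" using limit[of T g] g by blast
  moreover have "(R0 \<union> g ` T) \<inter> A \<noteq> {}" if "A \<in> T" for A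
    using g[of A] that unfolding Q_def by blast
  ultimately show ?thesis by blast
qed


section \<open>Ultrafilters of cylinders\<close>

lemma cyl_ultrafilter_empty_index:
  assumes "cyl_ultrafilter B {} U"
  shows "U = {{\<lambda>_. undefined}}"
proof -
  have "C = {} \<or> C = {\<lambda>_. undefined}" if "C \<in> U" for C
  proof -
    have "C \<in> cylinders B {}" using that assms unfolding cyl_ultrafilter_def by blast
    then have "C \<subseteq> {\<lambda>_. undefined}" unfolding cylinders_def by auto
    then show ?thesis by blast
  qed
  then show ?thesis using assms unfolding cyl_ultrafilter_def by auto
qed

lemma pull_uf_empty_index:
  assumes "cyl_ultrafilter B E L"
  shows "pull_uf B E L {} \<eta> = {{\<lambda>_. undefined}}"
  by (rule cyl_ultrafilter_empty_index[OF cyl_ultrafilter_pull_uf[OF assms]]) simp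

text \<open>A cylinder depends on finitely many coordinates, so finite index sets determine everything.\<close>

lemma pull_uf_eqI_finite:
  fixes B :: "'b set"
  assumes \<eta>: "\<eta> \<in> I \<rightarrow> E" and \<eta>': "\<eta>' \<in> I \<rightarrow> E'"
    and fin: "\<And>J. finite J \<Longrightarrow> J \<subseteq> I \<Longrightarrow> pull_uf B E L J \<eta> = pull_uf B E' L' J \<eta>'"
  shows "pull_uf B E L I \<eta> = pull_uf B E' L' I \<eta>'"
proof -
  have "C \<in> pull_uf B E L I \<eta> \<longleftrightarrow> C \<in> pull_uf B E' L' I \<eta>'" if C: "C \<in> cylinders B I" for C
  proof -
    obtain J P where J: "finite J" "J \<subseteq> I" and CP: "C = {\<psi> \<in> I \<rightarrow>\<^sub>E B. P (restrict \<psi> J)}"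
      using cylindersE[OF C] .
    define D where "D = {\<psi> \<in> J \<rightarrow>\<^sub>E B. P (restrict \<psi> J)}"
    have D: "D \<in> cylinders B J" unfolding D_def using J by (intro cylindersI) auto
    have key: "{\<psi> \<in> F \<rightarrow>\<^sub>E B. compose I \<psi> \<theta> \<in> C} = {\<psi> \<in> F \<rightarrow>\<^sub>E B. compose J \<psi> \<theta> \<in> D}"
      if \<theta>: "\<theta> \<in> I \<rightarrow> F" for \<theta> :: "_ \<Rightarrow> 'x" and F
    proof -
      have \<theta>J: "\<theta> \<in> J \<rightarrow> F" using \<theta> J by auto
      have r: "restrict (compose I \<psi> \<theta>) J = restrict (compose J \<psi> \<theta>) J" for \<psi> :: "_ \<Rightarrow> 'b"
        using J by (auto simp: compose_def restrict_def fun_eq_iff)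
      have "compose I \<psi> \<theta> \<in> C \<longleftrightarrow> compose J \<psi> \<theta> \<in> D" if "\<psi> \<in> F \<rightarrow>\<^sub>E B" for \<psi>
        unfolding CP D_def
        using compose_in_PiE[OF that \<theta>] compose_in_PiE[OF that \<theta>J] r[of \<psi>] by simp
      then show ?thesis by blast
    qed
    have "C \<in> pull_uf B E L I \<eta> \<longleftrightarrow> D \<in> pull_uf B E L J \<eta>"
      unfolding pull_uf_def mem_Collect_eq key[OF \<eta>] using C D by simp
    moreover have "C \<in> pull_uf B E' L' I \<eta>' \<longleftrightarrow> D \<in> pull_uf B E' L' J \<eta>'"
      unfolding pull_uf_def mem_Collect_eq key[OF \<eta>'] using C D by simp
    ultimately show ?thesis using fin[OF J] by simp
  qed
  then show ?thesis by (auto simp: pull_uf_def)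
qed

lemma cyl_ultrafilter_principal:
  assumes "\<phi> \<in> E \<rightarrow>\<^sub>E B"
  shows "cyl_ultrafilter B E {C \<in> cylinders B E. \<phi> \<in> C}"
  unfolding cyl_ultrafilter_def
  using assms by (auto simp: cylinders_top cylinders_Int cylinders_Diff)

lemma empty_ordLess:
  fixes m :: "'m rel"
  assumes "Card_order m" "Field m \<noteq> {}"
  shows "|{}| <o m"
proof -
  have "\<not> |Field m| \<le>o |{}|" using assms(2) card_of_empty3 by blast
  then have "|{}| <o |Field m|" using not_ordLeq_iff_ordLess[OF card_of_Well_order card_of_Well_order] by blast
  then show ?thesis using card_of_Field_ordIso[OF assms(1)] ordLess_ordIso_trans by blast
qed

text \<open>
  Distinct constants \<open>b\<close> give distinct principal ultrafilters on \<open>B\<^sup>1\<close>, each of which is the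
  ultrafilter of some element of \<open>E\<close>; thus \<open>B\<close> injects into \<open>E\<close>.
\<close>

lemma exact_infinite:
  fixes B :: "'b set" and m :: "'m rel"
  assumes B: "infinite B" and m: "Card_order m" "Field m \<noteq> {}"
    and L: "cyl_ultrafilter B E L" and ex: "exact m B E L"
  shows "infinite E"
proof -
  define U where "U b = {C \<in> cylinders B {()}. (\<lambda>_. b) \<in> C}" for b :: 'b
  have U: "cyl_ultrafilter B {()} (U b)" if "b \<in> B" for b
    unfolding U_def using that by (intro cyl_ultrafilter_principal) auto
  have small: "|{}::unit set| <o m" by (rule empty_ordLess[OF m])
  have "\<exists>e\<in>E. pull_uf B E L {()} (\<lambda>_. e) = U b" if b: "b \<in> B" for b
  proof -
    have "proj_uf B (insert () {}) (U b) {} = pull_uf B E L {} (\<lambda>_. undefined)"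
      unfolding proj_uf_eq pull_uf_empty_index[OF L] pull_uf_empty_index[OF U[OF b]] ..
    then obtain \<eta> where \<eta>: "\<eta> \<in> {()} \<rightarrow> E" "pull_uf B E L {()} \<eta> = U b"
      using exact_any_type[OF m(1) ex small, of "()" "\<lambda>_. undefined" "U b"] U[OF b] by auto
    have "pull_uf B E L {()} (\<lambda>_. \<eta> ()) = U b"
      unfolding \<eta>(2)[symmetric] by (rule pull_uf_cong) simp
    then show ?thesis by (rule bexI) (use \<eta>(1) in blast)
  qed
  then obtain e where e: "\<And>b. b \<in> B \<Longrightarrow> e b \<in> E \<and> pull_uf B E L {()} (\<lambda>_. e b) = U b"
    by metis
  have "inj_on e B"
  proof (rule inj_onI)
    fix b b' assume b: "b \<in> B" "b' \<in> B" "e b = e b'"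
    then have eq: "U b = U b'" using e by metis
    have "{\<psi> \<in> {()} \<rightarrow>\<^sub>E B. restrict \<psi> {()} () = b} \<in> cylinders B {()}"
      by (rule cylindersI) auto
    then have "{\<psi> \<in> {()} \<rightarrow>\<^sub>E B. restrict \<psi> {()} () = b} \<in> U b"
      unfolding U_def using b by auto
    then show "b = b'" unfolding eq unfolding U_def by auto
  qed
  moreover have "e ` B \<subseteq> E" using e by auto
  ultimately show ?thesis using B finite_subset finite_image_iff by metis
qed

lemma exact_infinite_card:
  fixes B :: "'b set" and m :: "'m rel"
  assumes B: "infinite B" and m: "Card_order m"
    and L: "cyl_ultrafilter B E L" and ex: "exact m B E L" and E: "|E| =o m" "E \<noteq> {}"
  shows "infinite (Field m)"
proof -
  have iso: "|E| =o |Field m|"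
    using E(1) card_of_Field_ordIso[OF m] ordIso_symmetric ordIso_transitive by blast
  then have "Field m \<noteq> {}" using E(2) by (metis card_of_empty2)
  then have "infinite E" using exact_infinite[OF B m _ L ex] by blast
  then show ?thesis using card_of_ordIso_finite[OF iso] by blast
qed


section \<open>Matchings between lim-rims\<close>

definition matching ::
  "'b set \<Rightarrow> 'e set \<Rightarrow> ('e \<Rightarrow> 'b) set set \<Rightarrow> 'f set \<Rightarrow> ('f \<Rightarrow> 'b) set set \<Rightarrow> ('e \<times> 'f) set \<Rightarrow> bool" where
  "matching B E1 L1 E2 L2 R \<longleftrightarrow>
     R \<subseteq> E1 \<times> E2 \<and> pull_uf B E1 L1 R fst = pull_uf B E2 L2 R snd"

lemma matching_projections:
  assumes "matching B E1 L1 E2 L2 R"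
  shows "fst \<in> R \<rightarrow> E1" "snd \<in> R \<rightarrow> E2"
  using assms unfolding matching_def by auto

text \<open>
  Pulling the common ultrafilter on \<open>B\<^sup>R\<close> further back along \<open>\<theta> : H \<rightarrow> R\<close> compares any two families
  with values in \<open>E1\<close> and \<open>E2\<close> that correspond under the matching.
\<close>

lemma matching_pull_uf:
  assumes R: "matching B E1 L1 E2 L2 R" and \<theta>: "\<theta> \<in> H \<rightarrow> R"
  shows "pull_uf B E1 L1 H (\<lambda>h. fst (\<theta> h)) = pull_uf B E2 L2 H (\<lambda>h. snd (\<theta> h))"
proof -
  have "pull_uf B E1 L1 H (\<lambda>h. fst (\<theta> h)) = pull_uf B R (pull_uf B E1 L1 R fst) H \<theta>"
    using pull_uf_pull_uf[OF \<theta> matching_projections(1)[OF R]] by metis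
  also have "\<dots> = pull_uf B R (pull_uf B E2 L2 R snd) H \<theta>"
    using R unfolding matching_def by simp
  also have "\<dots> = pull_uf B E2 L2 H (\<lambda>h. snd (\<theta> h))"
    by (rule pull_uf_pull_uf[OF \<theta> matching_projections(2)[OF R]])
  finally show ?thesis .
qed

lemma matching_subset:
  assumes "matching B E1 L1 E2 L2 R" "R' \<subseteq> R"
  shows "matching B E1 L1 E2 L2 R'"
proof -
  have "pull_uf B E1 L1 R' fst = pull_uf B E2 L2 R' snd"
    using matching_pull_uf[OF assms(1), of "\<lambda>p. p" R'] assms(2) by auto
  then show ?thesis using assms unfolding matching_def by blast
qed

lemma matching_converse:
  assumes R: "matching B E1 L1 E2 L2 R"
  shows "matching B E2 L2 E1 L1 (R\<inverse>)"
proof -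
  have "pull_uf B E1 L1 (R\<inverse>) snd = pull_uf B E2 L2 (R\<inverse>) fst"
    using matching_pull_uf[OF R, of prod.swap "R\<inverse>"] by (simp add: Pi_iff split_paired_all)
  then show ?thesis using R unfolding matching_def by auto
qed

lemma matching_empty:
  assumes "cyl_ultrafilter B E1 L1" "cyl_ultrafilter B E2 L2"
  shows "matching B E1 L1 E2 L2 {}"
  unfolding matching_def by (simp add: pull_uf_empty_index[OF assms(1)] pull_uf_empty_index[OF assms(2)])

lemma matching_finite_character:
  "matching B E1 L1 E2 L2 R \<longleftrightarrow> (\<forall>F\<subseteq>R. finite F \<longrightarrow> matching B E1 L1 E2 L2 F)"
proof
  assume fin: "\<forall>F\<subseteq>R. finite F \<longrightarrow> matching B E1 L1 E2 L2 F"
  have sub: "R \<subseteq> E1 \<times> E2"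
  proof
    fix p assume "p \<in> R"
    then have "matching B E1 L1 E2 L2 {p}" using fin by simp
    then show "p \<in> E1 \<times> E2" unfolding matching_def by simp
  qed
  then have "fst \<in> R \<rightarrow> E1" "snd \<in> R \<rightarrow> E2" by auto
  then have "pull_uf B E1 L1 R fst = pull_uf B E2 L2 R snd"
    by (rule pull_uf_eqI_finite) (use fin in \<open>simp add: matching_def\<close>)
  then show "matching B E1 L1 E2 L2 R" using sub unfolding matching_def by blast
qed (blast intro: matching_subset)

lemma matching_graph:
  assumes F: "F \<subseteq> E1" and f: "f \<in> F \<rightarrow> E2"
    and eq: "pull_uf B E2 L2 F f = sub_rim B E1 L1 F"
  shows "matching B E1 L1 E2 L2 ((\<lambda>x. (x, f x)) ` F)"
proof -
  define R where "R = (\<lambda>x. (x, f x)) ` F"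
  have fst: "fst \<in> R \<rightarrow> F" unfolding R_def by auto
  have "pull_uf B E1 L1 R fst = pull_uf B F (pull_uf B E1 L1 F (\<lambda>e. e)) R fst"
    using pull_uf_pull_uf[OF fst, of "\<lambda>e. e" E1 B L1] F by auto
  also have "\<dots> = pull_uf B F (pull_uf B E2 L2 F f) R fst"
    using eq unfolding sub_rim_def by simp
  also have "\<dots> = pull_uf B E2 L2 R (\<lambda>p. f (fst p))"
    using fst f by (rule pull_uf_pull_uf)
  also have "\<dots> = pull_uf B E2 L2 R snd"
    by (rule pull_uf_cong) (auto simp: R_def)
  finally show ?thesis using F f unfolding matching_def R_def by auto
qed

text \<open>
  If \<open>x\<close> is uncovered, then \<open>(x, undefined)\<close> is a fresh index for the new coordinate, and
  the ultrafilter to be realised over \<open>E2\<close> is the one that \<open>E1\<close> induces on \<open>R\<close> together with \<open>x\<close>.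
\<close>

lemma matching_forth:
  fixes \<kappa> :: "'k rel" and E2 :: "'f set"
  assumes \<kappa>: "Card_order \<kappa>" and L1: "cyl_ultrafilter B E1 L1" and ex: "exact \<kappa> B E2 L2"
    and R: "matching B E1 L1 E2 L2 R" and small: "|R| <o \<kappa>" and x: "x \<in> E1"
  shows "\<exists>u\<in>E2. matching B E1 L1 E2 L2 (insert (x, u) R)"
proof (cases "\<exists>u. (x, u) \<in> R")
  case True
  then obtain u where u: "(x, u) \<in> R" by blast
  then have "insert (x, u) R = R" "u \<in> E2" using R unfolding matching_def by auto
  then show ?thesis using R by metis
next
  case False
  define i where "i = (x, undefined :: 'f)"
  have i: "i \<notin> R" using False unfolding i_def by blast
  define K where "K = insert i R"
  have fstK: "fst \<in> K \<rightarrow> E1"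
    using matching_projections(1)[OF R] x unfolding K_def i_def by auto
  define U where "U = pull_uf B E1 L1 K fst"
  have U: "cyl_ultrafilter B K U"
    unfolding U_def using L1 fstK by (rule cyl_ultrafilter_pull_uf)
  have "proj_uf B K U R = pull_uf B E1 L1 R fst"
    unfolding proj_uf_eq U_def by (rule pull_uf_pull_uf) (use fstK in \<open>auto simp: K_def\<close>)
  then have proj: "proj_uf B K U R = pull_uf B E2 L2 R snd"
    using R unfolding matching_def by simp
  obtain \<eta> where \<eta>: "\<eta> \<in> K \<rightarrow> E2" "\<forall>p\<in>R. \<eta> p = snd p" "pull_uf B E2 L2 K \<eta> = U"
    using exact_any_type[OF \<kappa> ex small i matching_projections(2)[OF R]] U proj
    unfolding K_def by blast
  define u where "u = \<eta> i"
  have u: "u \<in> E2" using \<eta>(1) unfolding u_def K_def by auto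
  define S where "S = insert (x, u) R"
  \<comment> \<open>Replacing the index \<open>i\<close> by the pair \<open>(x, u)\<close> turns \<open>\<eta>\<close> into the second projection.\<close>
  define \<theta> where "\<theta> p = (if p \<in> R then p else i)" for p
  have \<theta>: "\<theta> \<in> S \<rightarrow> K" unfolding \<theta>_def K_def by auto
  have "pull_uf B E1 L1 S fst = pull_uf B E1 L1 S (\<lambda>p. fst (\<theta> p))"
    by (rule pull_uf_cong) (auto simp: \<theta>_def S_def i_def)
  also have "\<dots> = pull_uf B K U S \<theta>"
    unfolding U_def by (rule pull_uf_pull_uf[OF \<theta> fstK, symmetric])
  also have "\<dots> = pull_uf B E2 L2 S (\<lambda>p. \<eta> (\<theta> p))"
    unfolding \<eta>(3)[symmetric] by (rule pull_uf_pull_uf[OF \<theta> \<eta>(1)])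
  also have "\<dots> = pull_uf B E2 L2 S snd"
    by (rule pull_uf_cong) (use False \<eta>(2) in \<open>auto simp: \<theta>_def S_def u_def\<close>)
  finally have "matching B E1 L1 E2 L2 S"
    using R x u unfolding matching_def S_def by auto
  then show ?thesis using u unfolding S_def by blast
qed

lemma matching_back:
  fixes \<kappa> :: "'k rel"
  assumes \<kappa>: "Card_order \<kappa>" and L2: "cyl_ultrafilter B E2 L2" and ex: "exact \<kappa> B E1 L1"
    and R: "matching B E1 L1 E2 L2 R" and small: "|R| <o \<kappa>" and y: "y \<in> E2"
  shows "\<exists>v\<in>E1. matching B E1 L1 E2 L2 (insert (v, y) R)"
proof -
  have "R\<inverse> = prod.swap ` R" by force
  then have "|R\<inverse>| <o \<kappa>" using ordLeq_ordLess_trans[OF card_of_image small] by metis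
  then obtain v where v: "v \<in> E1" "matching B E2 L2 E1 L1 (insert (y, v) (R\<inverse>))"
    using matching_forth[OF \<kappa> L2 ex matching_converse[OF R] _ y] by blast
  have "(insert (y, v) (R\<inverse>))\<inverse> = insert (v, y) R" by auto
  then show ?thesis using matching_converse[OF v(2)] v(1) by auto
qed

text \<open>
  Over two pairs \<open>(x, u)\<close> and \<open>(x, u')\<close> of the matching, the condition \<open>\<psi> (x, u) = \<psi> (x, u')\<close> holds
  everywhere when read in \<open>E1\<close>, so its reading \<open>\<psi> u = \<psi> u'\<close> in \<open>E2\<close> belongs to \<open>L2\<close>.
\<close>

lemma matching_single_valued:
  assumes L1: "cyl_ultrafilter B E1 L1" and sep: "separated B E2 L2"
    and R: "matching B E1 L1 E2 L2 R" and p: "(x, u) \<in> R" "(x, u') \<in> R"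
  shows "u = u'"
proof -
  define C where "C = {\<psi> \<in> R \<rightarrow>\<^sub>E B. \<psi> (x, u) = \<psi> (x, u')}"
  have "C = {\<psi> \<in> R \<rightarrow>\<^sub>E B. restrict \<psi> {(x, u), (x, u')} (x, u) = restrict \<psi> {(x, u), (x, u')} (x, u')}"
    unfolding C_def by simp
  also have "\<dots> \<in> cylinders B R" using p by (intro cylindersI) auto
  finally have C: "C \<in> cylinders B R" .
  have "{\<psi> \<in> E1 \<rightarrow>\<^sub>E B. compose R \<psi> fst \<in> C} = (E1 \<rightarrow>\<^sub>E B)"
    using compose_in_PiE[OF _ matching_projections(1)[OF R]] p
    unfolding C_def by (auto simp: compose_def)
  then have "C \<in> pull_uf B E1 L1 R fst"
    using C L1 unfolding pull_uf_def cyl_ultrafilter_def by simp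
  then have "C \<in> pull_uf B E2 L2 R snd" using R unfolding matching_def by simp
  moreover have "{\<psi> \<in> E2 \<rightarrow>\<^sub>E B. compose R \<psi> snd \<in> C} = {\<psi> \<in> E2 \<rightarrow>\<^sub>E B. \<psi> u = \<psi> u'}"
    using compose_in_PiE[OF _ matching_projections(2)[OF R]] p
    unfolding C_def by (auto simp: compose_def)
  ultimately have "{\<psi> \<in> E2 \<rightarrow>\<^sub>E B. \<psi> u = \<psi> u'} \<in> L2" unfolding pull_uf_def by simp
  moreover have "u \<in> E2" "u' \<in> E2" using R p unfolding matching_def by auto
  ultimately show ?thesis using sep unfolding separated_def by blast
qed

lemma matching_total_embedding:
  assumes L1: "cyl_ultrafilter B E1 L1" and R: "matching B E1 L1 E2 L2 R"
    and g: "\<And>x. x \<in> E1 \<Longrightarrow> (x, g x) \<in> R"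
  shows "rim_embedding B E1 L1 E2 L2 g"
proof -
  have "pull_uf B E2 L2 E1 g = pull_uf B E1 L1 E1 (\<lambda>x. x)"
    using matching_pull_uf[OF R, of "\<lambda>x. (x, g x)" E1] g by auto
  moreover have "g \<in> E1 \<rightarrow> E2" using g R unfolding matching_def by auto
  ultimately show ?thesis unfolding rim_embedding_def using pull_uf_id[OF L1] by simp
qed


section \<open>Extending embeddings and isomorphisms\<close>

lemma embedding_extends:
  assumes B: "infinite B" and E: "cyl_ultrafilter B E L" "exact |E| B E L"
    and M: "cyl_ultrafilter B M LM" "|M| \<le>o |E|"
    and M': "M' \<subseteq> M" "|M'| <o |E|"
    and f: "rim_embedding B M' (sub_rim B M LM M') E L f"
  shows "\<exists>g. rim_embedding B M LM E L g \<and> (\<forall>x\<in>M'. g x = f x)"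
proof -
  have "E \<noteq> {}" using M'(2) by (metis card_of_empty not_ordLess_ordLeq)
  then have infE: "infinite (Field |E| )"
    using exact_infinite_card[OF B card_of_Card_order E card_of_refl] by blast
  define R0 where "R0 = (\<lambda>x. (x, f x)) ` M'"
  have R0: "matching B M LM E L R0"
    unfolding R0_def using f M'(1) unfolding rim_embedding_def by (intro matching_graph) auto
  have R0s: "|R0| <o |E|"
    unfolding R0_def using ordLeq_ordLess_trans[OF card_of_image M'(2)] .
  define T where "T = (\<lambda>x. {x} \<times> E) ` M"
  have T: "|T| \<le>o |E|" unfolding T_def using ordLeq_transitive[OF card_of_image M(2)] .
  have step: "\<exists>s\<in>A. matching B M LM E L (insert s R)"
    if "matching B M LM E L R" "|R| <o |E|" "A \<in> T" for R A
    using matching_forth[OF card_of_Card_order M(1) E(2) that(1,2)] that(3) unfolding T_def by blast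
  obtain R where R: "R0 \<subseteq> R" "matching B M LM E L R" "\<forall>A\<in>T. R \<inter> A \<noteq> {}"
    using finite_character_meets_all[where P = "matching B M LM E L",
        OF card_of_Card_order infE matching_finite_character step T R0 R0s] by blast
  have "\<exists>u. (x, u) \<in> R" if "x \<in> M" for x
  proof -
    have "R \<inter> ({x} \<times> E) \<noteq> {}" using R(3) that unfolding T_def by blast
    then show ?thesis by blast
  qed
  then obtain h where h: "\<And>x. x \<in> M \<Longrightarrow> (x, h x) \<in> R" by metis
  define g where "g x = (if x \<in> M' then f x else h x)" for x
  have "(x, g x) \<in> R" if "x \<in> M" for x
    using that h R(1) unfolding g_def R0_def by auto
  then have "rim_embedding B M LM E L g" by (rule matching_total_embedding[OF M(1) R(2)])
  then show ?thesis unfolding g_def by auto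
qed

lemma matching_extends_iso:
  fixes \<kappa> :: "'k rel"
  assumes \<kappa>: "Card_order \<kappa>" "infinite (Field \<kappa>)"
    and E1: "cyl_ultrafilter B E1 L1" "separated B E1 L1" "|E1| =o \<kappa>" "exact \<kappa> B E1 L1"
    and E2: "cyl_ultrafilter B E2 L2" "separated B E2 L2" "|E2| =o \<kappa>" "exact \<kappa> B E2 L2"
    and R0: "matching B E1 L1 E2 L2 R0" "|R0| <o \<kappa>"
  shows "\<exists>g. rim_iso B E1 L1 E2 L2 g \<and> (\<forall>(x, u)\<in>R0. g x = u)"
proof -
  define T where "T = (\<lambda>x. {x} \<times> E2) ` E1 \<union> (\<lambda>y. E1 \<times> {y}) ` E2"
  have "|(\<lambda>x. {x} \<times> E2) ` E1| \<le>o \<kappa>" "|(\<lambda>y. E1 \<times> {y}) ` E2| \<le>o \<kappa>"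
    using E1(3) E2(3) ordLeq_ordIso_trans[OF card_of_image] by blast+
  then have T: "|T| \<le>o \<kappa>"
    unfolding T_def using card_of_Un_ordLeq_infinite_Field[OF \<kappa>(2) _ _ \<kappa>(1)] by blast
  have step: "\<exists>s\<in>A. matching B E1 L1 E2 L2 (insert s R)"
    if R: "matching B E1 L1 E2 L2 R" "|R| <o \<kappa>" and A: "A \<in> T" for R A
  proof -
    consider x where "x \<in> E1" "A = {x} \<times> E2" | y where "y \<in> E2" "A = E1 \<times> {y}"
      using A unfolding T_def by blast
    then show ?thesis
    proof cases
      case 1
      then show ?thesis using matching_forth[OF \<kappa>(1) E1(1) E2(4) R] by blast
    next
      case 2
      then show ?thesis using matching_back[OF \<kappa>(1) E2(1) E1(4) R] by blast
    qed
  qed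
  obtain R where R: "R0 \<subseteq> R" "matching B E1 L1 E2 L2 R" "\<forall>A\<in>T. R \<inter> A \<noteq> {}"
    using finite_character_meets_all[where P = "matching B E1 L1 E2 L2",
        OF \<kappa> matching_finite_character step T R0] by blast
  have sub: "R \<subseteq> E1 \<times> E2" using R(2) unfolding matching_def by blast
  have sv: "u = u'" if "(x, u) \<in> R" "(x, u') \<in> R" for x u u'
    using matching_single_valued[OF E1(1) E2(2) R(2) that] .
  have inj: "x = x'" if "(x, u) \<in> R" "(x', u) \<in> R" for x x' u
    using matching_single_valued[OF E2(1) E1(2) matching_converse[OF R(2)]] that by blast
  have "\<exists>u. (x, u) \<in> R" if "x \<in> E1" for x
  proof -
    have "R \<inter> ({x} \<times> E2) \<noteq> {}" using R(3) that unfolding T_def by blast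
    then show ?thesis by blast
  qed
  then obtain g where g: "\<And>x. x \<in> E1 \<Longrightarrow> (x, g x) \<in> R" by metis
  have surj: "\<exists>x\<in>E1. g x = y" if "y \<in> E2" for y
  proof -
    have "R \<inter> (E1 \<times> {y}) \<noteq> {}" using R(3) that unfolding T_def by blast
    then obtain x where "x \<in> E1" "(x, y) \<in> R" by blast
    then show ?thesis using sv g by blast
  qed
  have emb: "rim_embedding B E1 L1 E2 L2 g"
    using matching_total_embedding[OF E1(1) R(2) g] .
  have "bij_betw g E1 E2"
  proof (rule bij_betw_imageI)
    show "inj_on g E1" by (rule inj_onI) (metis g inj)
    show "g ` E1 = E2" using emb surj unfolding rim_embedding_def by blast
  qed
  then have "rim_iso B E1 L1 E2 L2 g"
    using emb unfolding rim_iso_def rim_embedding_def by blast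
  moreover have "\<forall>(x, u)\<in>R0. g x = u" using R(1) sub sv g by blast
  ultimately show ?thesis by blast
qed

lemma iso_extends:
  fixes \<kappa> :: "'k rel"
  assumes B: "infinite B" and \<kappa>: "Card_order \<kappa>"
    and E1: "cyl_ultrafilter B E1 L1" "separated B E1 L1" "|E1| =o \<kappa>" "exact \<kappa> B E1 L1"
    and E2: "cyl_ultrafilter B E2 L2" "separated B E2 L2" "|E2| =o \<kappa>" "exact \<kappa> B E2 L2"
    and F: "F1 \<subseteq> E1" "F2 \<subseteq> E2" "|F1| <o \<kappa>"
    and f: "rim_iso B F1 (sub_rim B E1 L1 F1) F2 (sub_rim B E2 L2 F2) f"
  shows "\<exists>g. rim_iso B E1 L1 E2 L2 g \<and> (\<forall>x\<in>F1. g x = f x)"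
proof -
  have "|F1| <o |E1|" using F(3) E1(3) by (meson ordIso_symmetric ordLess_ordIso_trans)
  then have "E1 \<noteq> {}" by (metis card_of_empty not_ordLess_ordLeq)
  then have inf: "infinite (Field \<kappa>)" using exact_infinite_card[OF B \<kappa> E1(1,4,3)] by blast
  have fF: "f \<in> F1 \<rightarrow> F2" using f unfolding rim_iso_def bij_betw_def by blast
  have "pull_uf B F2 (pull_uf B E2 L2 F2 (\<lambda>e. e)) F1 f = pull_uf B E2 L2 F1 f"
    using pull_uf_pull_uf[OF fF, of "\<lambda>e. e" E2 B L2] F(2) by auto
  then have "pull_uf B E2 L2 F1 f = sub_rim B E1 L1 F1"
    using f unfolding rim_iso_def sub_rim_def by simp
  then have "matching B E1 L1 E2 L2 ((\<lambda>x. (x, f x)) ` F1)"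
    using F fF by (intro matching_graph) auto
  moreover have "|(\<lambda>x. (x, f x)) ` F1| <o \<kappa>"
    using ordLeq_ordLess_trans[OF card_of_image F(3)] .
  ultimately show ?thesis
    using matching_extends_iso[OF \<kappa> inf E1 E2] by fastforce
qed

text \<open>
  The empty matching starts the construction. The case of an empty \<open>\<kappa>\<close> is separate, because then
  the empty matching is not smaller than \<open>\<kappa>\<close> and exactness says nothing.
\<close>

lemma equal_card_exact_isomorphic:
  fixes \<kappa> :: "'k rel"
  assumes B: "infinite B" and \<kappa>: "Card_order \<kappa>"
    and E1: "cyl_ultrafilter B E1 L1" "separated B E1 L1" "|E1| =o \<kappa>" "exact \<kappa> B E1 L1"
    and E2: "cyl_ultrafilter B E2 L2" "separated B E2 L2" "|E2| =o \<kappa>" "exact \<kappa> B E2 L2"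
  shows "\<exists>g. rim_iso B E1 L1 E2 L2 g"
proof (cases "E1 = {}")
  case True
  have "|E2| =o |E1|" using ordIso_transitive[OF E2(3) ordIso_symmetric[OF E1(3)]] .
  then have "E2 = {}" using True by (metis card_of_empty2)
  then have "L1 = {{\<lambda>_. undefined}}" "L2 = {{\<lambda>_. undefined}}"
    using True E1(1) E2(1) cyl_ultrafilter_empty_index by blast+
  moreover have "pull_uf B E2 L2 {} (\<lambda>_. undefined) = {{\<lambda>_. undefined}}"
    by (rule pull_uf_empty_index[OF E2(1)])
  ultimately have "rim_iso B E1 L1 E2 L2 (\<lambda>_. undefined)"
    unfolding rim_iso_def using True \<open>E2 = {}\<close> by (simp add: bij_betw_def)
  then show ?thesis by blast
next
  case False
  have inf: "infinite (Field \<kappa>)" using exact_infinite_card[OF B \<kappa> E1(1,4,3) False] .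
  then have "Field \<kappa> \<noteq> {}" by auto
  then show ?thesis
    using matching_extends_iso[OF \<kappa> inf E1 E2 matching_empty[OF E1(1) E2(1)]] empty_ordLess[OF \<kappa>]
    by blast
qed

theorem mainTheorem3:
  fixes B :: "'b set"
  assumes "infinite B"
  shows
    "(\<forall>(E :: 'e set) L (M :: 'm set) LM M' f.
        lim_rim B E L \<and> separated B E L \<and> exact |E| B E L \<and>
        lim_rim B M LM \<and> |M| \<le>o |E| \<and> M' \<subseteq> M \<and> |M'| <o |E| \<and>
        rim_embedding B M' (sub_rim B M LM M') E L f \<longrightarrow>
        (\<exists>g. rim_embedding B M LM E L g \<and> (\<forall>x\<in>M'. g x = f x))) \<and>
     (\<forall>(\<kappa> :: 'k rel) (E1 :: 'e1 set) L1 (E2 :: 'e2 set) L2.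
        Card_order \<kappa> \<and>
        lim_rim B E1 L1 \<and> separated B E1 L1 \<and> |E1| =o \<kappa> \<and> exact \<kappa> B E1 L1 \<and>
        lim_rim B E2 L2 \<and> separated B E2 L2 \<and> |E2| =o \<kappa> \<and> exact \<kappa> B E2 L2 \<longrightarrow>
        (\<forall>F1 F2 f.
           F1 \<subseteq> E1 \<and> F2 \<subseteq> E2 \<and> |F1| <o \<kappa> \<and> |F2| <o \<kappa> \<and>
           rim_iso B F1 (sub_rim B E1 L1 F1) F2 (sub_rim B E2 L2 F2) f \<longrightarrow>
           (\<exists>g. rim_iso B E1 L1 E2 L2 g \<and> (\<forall>x\<in>F1. g x = f x))) \<and>
        (\<exists>g. rim_iso B E1 L1 E2 L2 g))"
proof (intro conjI allI impI, goal_cases)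
  case 1
  then show ?case
    unfolding lim_rim_def by (elim conjE) (rule embedding_extends[OF assms])
next
  case 2
  then show ?case
    unfolding lim_rim_def by (elim conjE) (rule iso_extends[OF assms])
next
  case 3
  then show ?case
    unfolding lim_rim_def by (elim conjE) (rule equal_card_exact_isomorphic[OF assms])
qed

end
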